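(* Let $n\ge1$, let $v_1,\dots,v_n\in\mathbb{R}\setminus\{0\}$, and let $S_v=v_1X_1+\cdots+v_nX_n$, where $X_1,\dots,X_n$ are independent Bernoulli random variables with variances $\sigma_1^2,\dots,\sigma_n^2$. Let $\sigma^2=\sum_{j=1}^n\sigma_j^2$, with $\sigma^2>0$. Then $$Q(S_v,0)\ \leq\ \frac{1}{\sqrt{6\sigma^2}}\int_0^{\sqrt{6\sigma^2}}e^{-t^2/2}\,dt.$$
   Context: For a discrete real-valued random variable $S$, $Q(S,0)=\max_{x\in\mathbb{R}}\mathbb{P}(S=x)$. A Bernoulli random variable $X$ takes values in $\{0,1\}$ with $\mathbb{P}(X=1)=p=1-\mathbb{P}(X=0)$ for some $p\in[0,1]$ (the parameters of the $X_i$ may differ). *)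

theory Defs
  imports "HOL-Probability.Probability"
begin

(* The value set {0,1} is required almost surely, so that the notion depends only on the law of X. *)
definition bernoulli_rv :: "'a measure \<Rightarrow> ('a \<Rightarrow> real) \<Rightarrow> real \<Rightarrow> bool" where
  "bernoulli_rv M X p \<longleftrightarrow>
     X \<in> borel_measurable M \<and> p \<in> {0..1} \<and> (AE \<omega> in M. X \<omega> \<in> {0, 1}) \<and>
     measure M {\<omega> \<in> space M. X \<omega> = 1} = p \<and> measure M {\<omega> \<in> space M. X \<omega> = 0} = 1 - p"

(* Q(S,0). The supremum is a maximum, see conc0_attained. *)
definition conc0 :: "'a measure \<Rightarrow> ('a \<Rightarrow> real) \<Rightarrow> real" where
  "conc0 M S = (SUP x. measure M {\<omega> \<in> space M. S \<omega> = x})"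

lemma (in prob_space) conc0_attained:
  assumes [measurable]: "S \<in> borel_measurable M"
  shows "\<exists>x. prob {\<omega> \<in> space M. S \<omega> = x} = conc0 M S"
    and "prob {\<omega> \<in> space M. S \<omega> = y} \<le> conc0 M S"
proof -
  define f where "f x = prob {\<omega> \<in> space M. S \<omega> = x}" for x
  have bdd: "bdd_above (range f)"
    by (rule bdd_aboveI[of _ 1]) (auto simp: f_def)
  have c: "conc0 M S = (SUP x. f x)" by (simp add: conc0_def f_def)
  have up: "f x \<le> conc0 M S" for x
    unfolding c by (rule cSUP_upper[OF _ bdd]) simp
  show "prob {\<omega> \<in> space M. S \<omega> = y} \<le> conc0 M S" using up[of y] by (simp add: f_def)
  have f0: "0 \<le> f x" for x by (simp add: f_def)
  have "\<exists>x. f x = conc0 M S"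
  proof (cases "conc0 M S > 0")
    case False
    then show ?thesis using f0[of 0] up[of 0] by (intro exI[of _ 0]) linarith
  next
    case True
    define s where "s = conc0 M S / 2"
    have s: "s > 0" "s < (SUP x. f x)" using True by (auto simp: s_def c)
    define A where "A = {x. s < f x}"
    have card: "real (card B) \<le> 1 / s" if B: "finite B" "B \<subseteq> A" for B
    proof -
      have "real (card B) * s \<le> (\<Sum>x\<in>B. f x)"
        using B(2) by (intro sum_bounded_below) (auto simp: A_def)
      also have "\<dots> = prob (\<Union>x\<in>B. {\<omega> \<in> space M. S \<omega> = x})"
        unfolding f_def
        by (rule finite_measure_finite_Union[symmetric])
           (use B(1) in \<open>auto simp: disjoint_family_on_def\<close>)
      also have "\<dots> \<le> 1" by simp
      finally show ?thesis using s(1) by (simp add: field_simps)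
    qed
    have fin: "finite A"
    proof (rule ccontr)
      assume "infinite A"
      then obtain B where "finite B" "card B = Suc (nat \<lceil>1 / s\<rceil>)" "B \<subseteq> A"
        using infinite_arbitrarily_large by metis
      with card[of B] show False by linarith
    qed
    obtain x0 where x0: "s < f x0"
      using s(2) less_cSUP_iff[OF _ bdd, of s] by auto
    have ne: "A \<noteq> {}" using x0 by (auto simp: A_def)
    have "Max (f ` A) \<in> f ` A" using fin ne by (intro Max_in) auto
    then obtain x where x: "x \<in> A" "f x = Max (f ` A)" by auto
    have "f y \<le> f x" for y
    proof (cases "y \<in> A")
      case True
      then show ?thesis using fin x(2) by simp
    next
      case False
      then show ?thesis using x(1) by (auto simp: A_def)
    qed
    then have "(SUP y. f y) \<le> f x" by (intro cSUP_least) auto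
    then show ?thesis using up[of x] c by (intro exI[of _ x]) simp
  qed
  then show "\<exists>x. prob {\<omega> \<in> space M. S \<omega> = x} = conc0 M S" by (simp add: f_def)
qed

end

theory Submission
  imports Defs
begin

text \<open>
  An atom is a time average: \<open>P(S = x)\<close> is the limit, as \<open>T\<close> tends to infinity, of the mean of
  \<open>E cos (t (S - x))\<close> over \<open>0 \<le> t \<le> T\<close>, and this integrand is at most the modulus of the
  characteristic function of \<open>S\<close>. With \<open>L\<close> the sum of the variances \<open>s\<^sub>i\<close>, that modulus is bounded
  by \<open>exp (- \<Sum>i. s\<^sub>i (1 - cos (v\<^sub>i t)))\<close>, hence, as \<open>exp\<close> is convex, by the average of the functions
  \<open>exp (- L (1 - cos (v\<^sub>i t)))\<close> with weights \<open>s\<^sub>i / L\<close>. The frequency \<open>v\<^sub>i\<close> does not affect a time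
  average, so every atom is at most \<open>E exp (- L Y)\<close>, where \<open>Y = 1 - cos (\<pi> U)\<close> with \<open>U\<close> uniform on
  \<open>[0, 1]\<close>. Finally \<open>Y\<close> and \<open>Z = 3 U\<^sup>2\<close> both have mean 1 and, as functions of \<open>U\<close>, cross only once in
  \<open>(0, 1]\<close>, so \<open>Y\<close> precedes \<open>Z\<close> in the convex order and \<open>E exp (- L Y) \<le> E exp (- L Z)\<close>, which is
  the asserted Gaussian integral after a substitution.
\<close>

section \<open>Convex-order comparison of \<open>1 - cos (pi * u)\<close> with
  \<open>3 * u\<^sup>2\<close>\<close>

text \<open>Sine is concave on [0, pi] and vanishes at 0. Concretely,
  \<open>sin (s * x) - s * sin x\<close> has a nonnegative derivative because cosine decreases
  there. Equivalently, sin y / y is nonincreasing on (0, pi].\<close>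

lemma sin_mult_ge:
  fixes s y :: real
  assumes "0 \<le> s" "s \<le> 1" "0 \<le> y" "y \<le> pi"
  shows "s * sin y \<le> sin (s * y)"
proof -
  have "sin (s * 0) - s * sin 0 \<le> sin (s * y) - s * sin y"
  proof (rule DERIV_nonneg_imp_nondecreasing[OF \<open>0 \<le> y\<close>])
    fix x assume x: "0 \<le> x" "x \<le> y"
    have "((\<lambda>x. sin (s * x) - s * sin x) has_real_derivative s * (cos (s * x) - cos x)) (at x)"
      by (auto intro!: derivative_eq_intros simp: algebra_simps)
    moreover have "s * x \<le> x"
      using assms x by (simp add: mult_left_le_one_le)
    then have "cos x \<le> cos (s * x)"
      using assms x by (intro cos_monotone_0_pi_le) auto
    ultimately show "\<exists>d. ((\<lambda>x. sin (s * x) - s * sin x) has_real_derivative d) (at x) \<and> 0 \<le> d"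
      using assms by (intro exI[of _ "s * (cos (s * x) - cos x)"] conjI) auto
  qed
  then show ?thesis by simp
qed

lemma one_minus_cos_pi: "1 - cos (pi * u) = 2 * (sin (u * (pi / 2)))\<^sup>2" for u :: real
  using cos_double_sin[of "u * (pi / 2)"] by (simp add: mult_ac)

text \<open>In half-angle form the quotient of the two functions is a constant times the square of
  sin (u pi / 2) / u, which is nonincreasing on (0, 1] by \<open>sin_mult_ge\<close>. Hence it is at
  least 1 before a point \<open>c\<close> of equality and at most 1 after it.\<close>

lemma one_minus_cos_crosses_square:
  obtains c :: real where "0 < c" "c \<le> 1" "1 - cos (pi * c) = 3 * c\<^sup>2"
    "\<And>u. 0 \<le> u \<Longrightarrow> u \<le> c \<Longrightarrow> 3 * u\<^sup>2 \<le> 1 - cos (pi * u)"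
    "\<And>u. c \<le> u \<Longrightarrow> u \<le> 1 \<Longrightarrow> 1 - cos (pi * u) \<le> 3 * u\<^sup>2"
proof -
  \<comment> \<open>The difference is 1/4 at 1/2 and -1 at 1. Starting at 1/2 excludes the trivial
    zero at 0.\<close>
  have "\<exists>c\<ge>1/2. c \<le> 1 \<and> 1 - cos (pi * c) - 3 * c\<^sup>2 = (0::real)"
    by (rule IVT2') (auto simp: power2_eq_square intro!: continuous_intros)
  then obtain c :: real where c: "1/2 \<le> c" "c \<le> 1" "1 - cos (pi * c) = 3 * c\<^sup>2"
    by auto
  have sin_c: "2 * (sin (c * (pi / 2)))\<^sup>2 = 3 * c\<^sup>2"
    using c(3) one_minus_cos_pi[of c] by simp
  show ?thesis
  proof (rule that[of c])
    fix u :: real assume u: "0 \<le> u" "u \<le> c"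
    have "(u / c) * sin (c * (pi / 2)) \<le> sin ((u / c) * (c * (pi / 2)))"
      using u c by (intro sin_mult_ge) (auto simp: field_simps)
    then have "(u / c) * sin (c * (pi / 2)) \<le> sin (u * (pi / 2))"
      using c by simp
    moreover have "0 \<le> sin (c * (pi / 2))"
      using c by (intro sin_ge_zero) (auto simp: field_simps)
    ultimately have "((u / c) * sin (c * (pi / 2)))\<^sup>2 \<le> (sin (u * (pi / 2)))\<^sup>2"
      using u c by (intro power_mono) auto
    then have "(u / c)\<^sup>2 * (2 * (sin (c * (pi / 2)))\<^sup>2) \<le> 1 - cos (pi * u)"
      by (simp add: one_minus_cos_pi power_mult_distrib power_divide mult_ac)
    then show "3 * u\<^sup>2 \<le> 1 - cos (pi * u)"
      using c(1) unfolding sin_c by (simp add: power_divide)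
  next
    fix u :: real assume u: "c \<le> u" "u \<le> 1"
    have "(c / u) * sin (u * (pi / 2)) \<le> sin ((c / u) * (u * (pi / 2)))"
      using u c by (intro sin_mult_ge) (auto simp: field_simps)
    then have "(c / u) * sin (u * (pi / 2)) \<le> sin (c * (pi / 2))"
      using u c by simp
    moreover have "0 \<le> sin (u * (pi / 2))"
      using u c by (intro sin_ge_zero) (auto simp: field_simps)
    ultimately have "((c / u) * sin (u * (pi / 2)))\<^sup>2 \<le> (sin (c * (pi / 2)))\<^sup>2"
      using u c by (intro power_mono) auto
    then have "(c / u)\<^sup>2 * (1 - cos (pi * u)) \<le> 3 * c\<^sup>2"
      using c(3) by (simp add: one_minus_cos_pi power_mult_distrib power_divide mult_ac)
    then have "c\<^sup>2 * (1 - cos (pi * u)) \<le> c\<^sup>2 * (3 * u\<^sup>2)"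
      using u c(1) by (simp add: power_divide field_simps)
    then show "1 - cos (pi * u) \<le> 3 * u\<^sup>2"
      using c(1) by (subst (asm) mult_le_cancel_left_pos) auto
  qed (use c in auto)
qed

lemma integral_exp_cos_le:
  fixes L :: real
  assumes "0 \<le> L"
  shows "integral {0..1} (\<lambda>u. exp (- L * (1 - cos (pi * u))))
       \<le> integral {0..1} (\<lambda>u. exp (- L * (3 * u\<^sup>2)))"
proof -
  define Y where "Y u = 1 - cos (pi * u)" for u :: real
  define Z where "Z u = 3 * u\<^sup>2" for u :: real
  obtain c where c: "0 < c" "c \<le> 1" "Y c = Z c"
    "\<And>u. 0 \<le> u \<Longrightarrow> u \<le> c \<Longrightarrow> Z u \<le> Y u" "\<And>u. c \<le> u \<Longrightarrow> u \<le> 1 \<Longrightarrow> Y u \<le> Z u"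
    unfolding Y_def Z_def by (rule one_minus_cos_crosses_square) blast
  have mono: "Y u \<le> Y w" if "0 \<le> u" "u \<le> w" "w \<le> 1" for u w
    using that unfolding Y_def by (simp add: cos_monotone_0_pi_le)
  \<comment> \<open>Bound the convex exponential below by its tangent at \<open>Y u\<close>; by the single crossing, replacing the
    slope there by the slope at \<open>Y c\<close> only weakens the bound, and the correction has mean zero.\<close>
  have ptw: "exp (- L * Y u) \<le> exp (- L * Z u) + L * exp (- L * Y c) * (Z u - Y u)"
    if u: "u \<in> {0..1}" for u
  proof -
    have "exp (- L * Y u) * (1 + - L * (Z u - Y u)) \<le> exp (- L * Y u) * exp (- L * (Z u - Y u))"
      by (intro mult_left_mono exp_ge_add_one_self) auto
    also have "\<dots> = exp (- L * Z u)"
      by (simp add: exp_add[symmetric] algebra_simps)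
    finally have tangent: "exp (- L * Y u) \<le> exp (- L * Z u) + L * (exp (- L * Y u) * (Z u - Y u))"
      by (simp add: algebra_simps)
    have "exp (- L * Y u) * (Z u - Y u) \<le> exp (- L * Y c) * (Z u - Y u)"
    proof (cases "u \<le> c")
      case True
      have "exp (- L * Y c) \<le> exp (- L * Y u)"
        using mono[of u c] u True c assms by (simp add: mult_left_mono)
      then show ?thesis using c(4)[of u] u True by (intro mult_right_mono_neg) auto
    next
      case False
      have "exp (- L * Y u) \<le> exp (- L * Y c)"
        using mono[of c u] u False c assms by (simp add: mult_left_mono)
      then show ?thesis using c(5)[of u] u False by (intro mult_right_mono) auto
    qed
    from mult_left_mono[OF this assms] show ?thesis using tangent by (simp add: mult_ac)
  qed
  \<comment> \<open>An antiderivative is u^3 - u + sin (pi u) / pi. The value is written as its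
    unsimplified difference between 1 and 0 so that the fundamental theorem applies by
    matching.\<close>
  have "((\<lambda>u. Z u - Y u) has_integral
      ((1 ^ 3 - 1 + sin (pi * 1) / pi) - (0 ^ 3 - 0 + sin (pi * 0) / pi))) {0..1::real}"
    unfolding Y_def Z_def
    by (rule fundamental_theorem_of_calculus)
       (auto intro!: derivative_eq_intros simp: has_real_derivative_iff_has_vector_derivative[symmetric])
  then have mean: "((\<lambda>u. Z u - Y u) has_integral 0) {0..1}"
    by simp
  have cont: "continuous_on {0..1} Y" "continuous_on {0..1} Z"
    unfolding Y_def Z_def by (auto intro!: continuous_intros)
  have "((\<lambda>u. exp (- L * Z u) + L * exp (- L * Y c) * (Z u - Y u)) has_integral
      integral {0..1} (\<lambda>u. exp (- L * Z u)) + L * exp (- L * Y c) * 0) {0..1}"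
    by (intro has_integral_add has_integral_mult_right mean integrable_integral
          integrable_continuous_interval continuous_intros cont)
  moreover have "((\<lambda>u. exp (- L * Y u)) has_integral integral {0..1} (\<lambda>u. exp (- L * Y u))) {0..1}"
    by (intro integrable_integral integrable_continuous_interval continuous_intros cont)
  ultimately have "integral {0..1} (\<lambda>u. exp (- L * Y u)) \<le>
      integral {0..1} (\<lambda>u. exp (- L * Z u)) + L * exp (- L * Y c) * 0"
    using has_integral_le ptw by blast
  then show ?thesis by (simp add: Y_def Z_def)
qed

section \<open>Integrals of periodic functions over long intervals\<close>

lemma integral_Icc_stretch:
  fixes f :: "real \<Rightarrow> real"
  assumes "0 < m"
  shows "integral {0..b} (\<lambda>x. f (m * x)) = integral {0..m * b} f / m"
proof -
  have "(\<lambda>x. x / m) ` {0..m * b} = {0..b}"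
    using assms by (force simp: image_iff field_simps intro: bexI[of _ "m * _"])
  then show ?thesis
    using integral_stretch_real[of m 0 "m * b" f] assms by simp
qed

text \<open>Since \<open>h\<close> is nonnegative, [0, T] may be enlarged to a whole number of
  periods, at the cost of at most one extra period.\<close>

lemma integral_periodic_le:
  fixes h :: "real \<Rightarrow> real"
  assumes cont: "continuous_on UNIV h" and nonneg: "\<And>x. 0 \<le> h x"
    and per: "\<And>x. h (x + P) = h x" and "0 < P" "0 \<le> T"
  shows "integral {0..T} h \<le> (T / P + 1) * integral {0..P} h"
proof -
  have int: "h integrable_on {a..b}" for a b
    using cont by (intro integrable_continuous_interval) (rule continuous_on_subset, auto)
  have per': "h (x + real N * P) = h x" for x N
  proof (induction N)
    case (Suc N)
    show ?case using per[of "x + real N * P"] Suc by (simp add: algebra_simps)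
  qed simp
  have eq: "integral {0..real N * P} h = real N * integral {0..P} h" for N
  proof (induction N)
    case (Suc N)
    have "integral {0..real (Suc N) * P} h =
        integral {0..real N * P} h + integral {real N * P..real (Suc N) * P} h"
      using int \<open>0 < P\<close> by (intro Henstock_Kurzweil_Integration.integral_combine[symmetric]) (auto simp: algebra_simps)
    also have "integral {real N * P..real (Suc N) * P} h = integral {0..P} (\<lambda>x. h (x + real N * P))"
      using integral_shift_real_ivl[of "real N * P" "real N * P" "real (Suc N) * P" h]
      by (simp add: algebra_simps)
    finally show ?case by (simp only: per' Suc) (simp add: algebra_simps)
  qed simp
  define N where "N = nat \<lceil>T / P\<rceil>"
  have N: "T / P \<le> real N" "real N \<le> T / P + 1"
    using assms by (auto simp: N_def intro: of_nat_ceiling)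
  have "integral {0..T} h \<le> integral {0..real N * P} h"
    using N(1) \<open>0 < P\<close> nonneg int by (intro integral_subset_le) (auto simp: field_simps)
  also have "\<dots> \<le> (T / P + 1) * integral {0..P} h"
    unfolding eq using N(2) nonneg int by (intro mult_right_mono integral_nonneg) auto
  finally show ?thesis .
qed

text \<open>The reflection of u to 2 - u preserves cos (pi u) and swaps the two halves of the
  period. Only [0, 1] remains, where the cosine is monotone, as the comparison above
  requires.\<close>

lemma integral_cos_full_period:
  fixes \<kappa> :: "real \<Rightarrow> real"
  assumes cont: "continuous_on UNIV \<kappa>"
  shows "integral {0..2} (\<lambda>u. \<kappa> (cos (pi * u))) = 2 * integral {0..1} (\<lambda>u. \<kappa> (cos (pi * u)))"
proof -
  define k where "k u = \<kappa> (cos (pi * u))" for u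
  have k: "continuous_on S k" for S
    unfolding k_def
    by (rule continuous_on_compose2[OF cont]) (auto intro!: continuous_intros)
  have int: "k integrable_on {a..b}" for a b
    by (intro integrable_continuous_interval k)
  have "(k has_integral integral {0..1} k) (cbox 0 1)"
    using int[of 0 1] by (simp add: has_integral_integral)
  from has_integral_affinity[OF this, of "-1" 2]
  have "((\<lambda>x. k (2 - x)) has_integral integral {0..1} k) ((\<lambda>x. 2 - x) ` {0..1})"
    by (simp add: algebra_simps)
  moreover have "(\<lambda>x. 2 - x) ` {0..1} = {1..2::real}"
    by (auto simp: image_iff intro: bexI[of _ "2 - _"])
  moreover have "k (2 - x) = k x" for x
    by (simp add: k_def right_diff_distrib cos_diff mult.commute[of pi 2])
  ultimately have "integral {1..2} k = integral {0..1} k"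
    by (simp add: integral_unique)
  moreover have "integral {0..1} k + integral {1..2} k = integral {0..2} k"
    using int by (intro Henstock_Kurzweil_Integration.integral_combine) auto
  ultimately show ?thesis by (simp add: k_def[abs_def])
qed

text \<open>The frequency enters only through the additive error 2 pi / |v|, one full period, which
  disappears on division by \<open>T\<close> as \<open>T\<close> grows. The main term does not
  depend on \<open>v\<close>.\<close>

lemma integral_cos_frequency_le:
  fixes \<kappa> :: "real \<Rightarrow> real"
  assumes cont: "continuous_on UNIV \<kappa>" and nonneg: "\<And>x. 0 \<le> \<kappa> x" and "v \<noteq> 0" "0 \<le> T"
  shows "integral {0..T} (\<lambda>t. \<kappa> (cos (v * t)))
       \<le> (T + 2 * pi / \<bar>v\<bar>) * integral {0..1} (\<lambda>u. \<kappa> (cos (pi * u)))"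
proof -
  \<comment> \<open>With this scale, v t equals pi (m t) up to sign, and the rescaled function
    \<open>k\<close> has period 2 for every \<open>v\<close>.\<close>
  define m where "m = \<bar>v\<bar> / pi"
  define k where "k u = \<kappa> (cos (pi * u))" for u
  have m: "0 < m" "pi * m = \<bar>v\<bar>" using assms by (auto simp: m_def)
  have k: "continuous_on S k" for S
    unfolding k_def
    by (rule continuous_on_compose2[OF cont]) (auto intro!: continuous_intros)
  have "\<kappa> (cos (v * t)) = k (m * t)" for t
  proof -
    have "cos (v * t) = cos (\<bar>v\<bar> * t)" by (cases "0 \<le> v") auto
    then show ?thesis by (simp add: k_def m mult.assoc[symmetric])
  qed
  then have "integral {0..T} (\<lambda>t. \<kappa> (cos (v * t))) = integral {0..m * T} k / m"
    using integral_Icc_stretch[OF m(1)] by simp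
  also have "\<dots> \<le> ((m * T) / 2 + 1) * integral {0..2} k / m"
  proof (intro divide_right_mono integral_periodic_le k)
    show "k (x + 2) = k x" for x
      by (simp add: k_def distrib_left cos_add mult.commute[of pi 2])
  qed (use assms m in \<open>auto simp: k_def\<close>)
  also have "\<dots> = (T + 2 / m) * integral {0..1} k"
    using m integral_cos_full_period[OF cont] by (simp add: k_def[abs_def] field_simps)
  also have "2 / m = 2 * pi / \<bar>v\<bar>" by (simp add: m_def)
  finally show ?thesis by (simp add: k_def[abs_def])
qed

section \<open>Moments and characteristic functions of Bernoulli variables\<close>

lemma (in prob_space) bernoulli_rv_moments:
  fixes p :: real
  assumes "bernoulli_rv M X p"
  shows "integrable M X" "expectation X = p" "variance X = p * (1 - p)"
proof -
  have [measurable]: "X \<in> borel_measurable M" and AE: "AE \<omega> in M. X \<omega> \<in> {0, 1}"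
    and p: "prob {\<omega> \<in> space M. X \<omega> = 1} = p"
    using assms by (auto simp: bernoulli_rv_def)
  have b: "AE \<omega> in M. norm (X \<omega>) \<le> 1" using AE by eventually_elim auto
  show int: "integrable M X" by (rule integrable_const_bound[OF b]) auto
  have "expectation X = expectation (indicator {\<omega> \<in> space M. X \<omega> = 1})"
    using AE by (intro integral_cong_AE) (auto split: split_indicator elim!: eventually_mono)
  then show E: "expectation X = p" by (simp add: p)
  \<comment> \<open>On {0, 1} the square of \<open>X\<close> is \<open>X\<close> itself, so the
    squared deviation is affine in \<open>X\<close>.\<close>
  have "variance X = expectation (\<lambda>\<omega>. X \<omega> * (1 - 2 * p) + p\<^sup>2)"
    unfolding E using AE
    by (intro integral_cong_AE) (auto simp: power2_eq_square algebra_simps elim!: eventually_mono)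
  also have "\<dots> = p * (1 - p)"
    using int by (simp add: E prob_space power2_eq_square algebra_simps)
  finally show "variance X = p * (1 - p)" .
qed

text \<open>The squared modulus is exactly 1 - 2 p (1 - p) (1 - cos (v t)). Then 1 + x is at most
  exp x, and taking the square root removes the factor 2.\<close>

lemma (in prob_space) norm_char_bernoulli_le:
  assumes "bernoulli_rv M X p"
  shows "norm (char (distr M borel (\<lambda>\<omega>. v * X \<omega>)) t) \<le> exp (- variance X * (1 - cos (v * t)))"
proof -
  have [measurable]: "X \<in> borel_measurable M" and AE: "AE \<omega> in M. X \<omega> \<in> {0, 1}"
    using assms by (auto simp: bernoulli_rv_def)
  note X = bernoulli_rv_moments[OF assms]
  have "char (distr M borel (\<lambda>\<omega>. v * X \<omega>)) t = (CLINT \<omega>|M. iexp (t * (v * X \<omega>)))"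
    unfolding char_def by (subst integral_distr) auto
  \<comment> \<open>For \<open>X\<close> in {0, 1} the exponential is affine in \<open>X\<close>, so
    its expectation follows by linearity.\<close>
  also have "\<dots> = (CLINT \<omega>|M. 1 + complex_of_real (X \<omega>) * (iexp (v * t) - 1))"
    using AE by (intro integral_cong_AE) (auto simp: mult_ac elim!: eventually_mono)
  also have "\<dots> = 1 + complex_of_real p * (iexp (v * t) - 1)"
    using X by (simp add: prob_space)
  finally have "(norm (char (distr M borel (\<lambda>\<omega>. v * X \<omega>)) t))\<^sup>2
      = (1 + p * (cos (v * t) - 1))\<^sup>2 + (p * sin (v * t))\<^sup>2"
    by (simp add: cmod_power2 Re_exp Im_exp)
  also have "\<dots> = 1 + - 2 * (p * (1 - p)) * (1 - cos (v * t))"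
    using sin_cos_squared_add[of "v * t"] by algebra
  also have "\<dots> \<le> exp (- 2 * (p * (1 - p)) * (1 - cos (v * t)))"
    by (rule exp_ge_add_one_self)
  also have "\<dots> = (exp (- variance X * (1 - cos (v * t))))\<^sup>2"
    by (simp add: X(3) exp_double[symmetric] algebra_simps)
  finally show ?thesis by (rule power2_le_imp_le) simp
qed

text \<open>A real part is at most the modulus, and the shift by \<open>x\<close> only contributes a
  factor of modulus 1. The bound is therefore uniform in \<open>x\<close>.\<close>

lemma (in prob_space) expectation_cos_le_norm_char:
  assumes [measurable]: "S \<in> borel_measurable M"
  shows "expectation (\<lambda>\<omega>. cos (t * (S \<omega> - x))) \<le> norm (char (distr M borel S) t)"
proof -
  have int: "integrable M (\<lambda>\<omega>. iexp (t * (S \<omega> - x)))"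
    by (rule integrable_const_bound[of _ 1]) auto
  have "expectation (\<lambda>\<omega>. cos (t * (S \<omega> - x))) = expectation (\<lambda>\<omega>. Re (iexp (t * (S \<omega> - x))))"
    by (simp add: Re_exp)
  also have "\<dots> = Re (CLINT \<omega>|M. iexp (t * (S \<omega> - x)))"
    by (rule integral_Re[OF int])
  also have "\<dots> \<le> norm (CLINT \<omega>|M. iexp (t * (S \<omega> - x)))"
    by (rule complex_Re_le_cmod)
  also have "(CLINT \<omega>|M. iexp (t * (S \<omega> - x))) = (CLINT \<omega>|M. iexp (- t * x) * iexp (t * S \<omega>))"
    by (simp add: exp_add[symmetric] algebra_simps)
  also have "\<dots> = iexp (- t * x) * char (distr M borel S) t"
    unfolding char_def by (subst integral_distr) auto
  also have "norm \<dots> = norm (char (distr M borel S) t)"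
    by (simp add: norm_mult)
  finally show ?thesis .
qed

section \<open>Atoms as limits of time averages\<close>

text \<open>For nonzero \<open>y\<close> the integral is sin (T y) / y, which stays bounded while
  \<open>T\<close> grows; for \<open>y = 0\<close> the integrand is 1. Using \<open>Suc k\<close>
  keeps the length of the interval positive.\<close>

lemma time_average_cos_LIMSEQ:
  fixes y :: real
  shows "(\<lambda>k. (LBINT t:{0..real (Suc k)}. cos (t * y)) / real (Suc k)) \<longlonglongrightarrow> indicator {0} y"
proof (cases "y = 0")
  case True
  then show ?thesis by (simp add: set_integral_const[unfolded scaleR_conv_of_real] set_lebesgue_integral_def)
next
  case False
  have eq: "(LBINT t:{0..real (Suc k)}. cos (t * y)) = sin (real (Suc k) * y) / y" for k
  proof -
    have "((\<lambda>t. cos (t * y)) has_integral sin (real (Suc k) * y) / y - sin (0 * y) / y) {0..real (Suc k)}"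
      using False by (intro fundamental_theorem_of_calculus)
       (auto intro!: derivative_eq_intros simp: has_real_derivative_iff_has_vector_derivative[symmetric])
    moreover have "set_integrable lborel {0..real (Suc k)} (\<lambda>t. cos (t * y))"
      by (intro borel_integrable_atLeastAtMost') (auto intro!: continuous_intros)
    ultimately show ?thesis
      by (simp add: set_borel_integral_eq_integral integral_unique)
  qed
  have "(\<lambda>k. sin (real (Suc k) * y) / y / real (Suc k)) \<longlonglongrightarrow> 0"
  proof (rule Lim_null_comparison)
    show "\<forall>\<^sub>F k in sequentially. norm (sin (real (Suc k) * y) / y / real (Suc k)) \<le> inverse (real (Suc k)) / \<bar>y\<bar>"
    proof (intro always_eventually allI)
      fix k
      have "\<bar>sin (real (Suc k) * y)\<bar> * (inverse (real (Suc k)) / \<bar>y\<bar>) \<le> 1 * (inverse (real (Suc k)) / \<bar>y\<bar>)"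
        by (intro mult_right_mono abs_sin_le_one) auto
      then show "norm (sin (real (Suc k) * y) / y / real (Suc k)) \<le> inverse (real (Suc k)) / \<bar>y\<bar>"
        by (simp add: abs_mult divide_inverse mult_ac del: of_nat_Suc)
    qed
    show "(\<lambda>k. inverse (real (Suc k)) / \<bar>y\<bar>) \<longlonglongrightarrow> 0"
      by (rule tendsto_divide_zero[OF LIMSEQ_inverse_real_of_nat])
  qed
  then show ?thesis using False eq by simp
qed

text \<open>Fubini moves the time average inside the expectation, where it converges pointwise to
  the indicator of \<open>Y = 0\<close>. Every average has absolute value at most 1, so dominated
  convergence applies.\<close>

lemma (in prob_space) time_average_LIMSEQ_atom:
  assumes [measurable]: "Y \<in> borel_measurable M"
  shows "(\<lambda>k. (LBINT t:{0..real (Suc k)}. expectation (\<lambda>\<omega>. cos (t * Y \<omega>))) / real (Suc k))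
    \<longlonglongrightarrow> prob {\<omega> \<in> space M. Y \<omega> = 0}"
proof -
  interpret pair_sigma_finite M lborel ..
  have fub: "(LBINT t:{0..T}. expectation (\<lambda>\<omega>. cos (t * Y \<omega>)))
      = expectation (\<lambda>\<omega>. LBINT t:{0..T}. cos (t * Y \<omega>))" for T :: real
  proof -
    have fin: "emeasure (M \<Otimes>\<^sub>M lborel) (space M \<times> {0..T}) < \<infinity>"
      by (simp add: lborel.emeasure_pair_measure_Times emeasure_space_1 emeasure_lborel_Icc_eq)
    have "integrable (M \<Otimes>\<^sub>M lborel) (\<lambda>(\<omega>, t). indicator {0..T} t *\<^sub>R cos (t * Y \<omega>))"
    proof (rule Bochner_Integration.integrable_bound)
      show "integrable (M \<Otimes>\<^sub>M lborel) (indicator (space M \<times> {0..T}) :: _ \<Rightarrow> real)"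
        using fin by (intro integrable_real_indicator) auto
      show "AE z in M \<Otimes>\<^sub>M lborel. norm (case z of (\<omega>, t) \<Rightarrow> indicator {0..T} t *\<^sub>R cos (t * Y \<omega>))
          \<le> norm (indicator (space M \<times> {0..T}) z :: real)"
        by (rule AE_I2) (auto simp: space_pair_measure indicator_def)
    qed auto
    from Fubini_integral[OF this] show ?thesis
      by (simp add: set_lebesgue_integral_def)
  qed
  have bnd: "\<bar>LBINT t:{0..T}. cos (t * y)\<bar> \<le> T" if "0 \<le> T" for T y :: real
  proof -
    have "norm (LBINT t. indicator {0..T} t *\<^sub>R cos (t * y)) \<le> (LBINT t. indicator {0..T} t)"
      using that by (intro Bochner_Integration.integral_norm_bound_integral borel_integrable_atLeastAtMost'[unfolded set_integrable_def])
        (auto intro!: continuous_intros split: split_indicator simp: integrable_real_indicator emeasure_lborel_Icc_eq)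
    then show ?thesis using that by (simp add: set_lebesgue_integral_def)
  qed
  have meas[measurable]: "(\<lambda>\<omega>. LBINT t:{0..T}. cos (t * Y \<omega>)) \<in> borel_measurable M" for T :: real
    unfolding set_lebesgue_integral_def by measurable
  have "(\<lambda>k. expectation (\<lambda>\<omega>. (LBINT t:{0..real (Suc k)}. cos (t * Y \<omega>)) / real (Suc k)))
      \<longlonglongrightarrow> expectation (\<lambda>\<omega>. indicator {0} (Y \<omega>))"
  proof (rule integral_dominated_convergence[where w = "\<lambda>_. 1"])
    show "AE \<omega> in M. (\<lambda>k. (LBINT t:{0..real (Suc k)}. cos (t * Y \<omega>)) / real (Suc k))
        \<longlonglongrightarrow> indicator {0} (Y \<omega>)"
      by (intro AE_I2 time_average_cos_LIMSEQ)
    show "AE \<omega> in M. norm ((LBINT t:{0..real (Suc k)}. cos (t * Y \<omega>)) / real (Suc k)) \<le> 1" for k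
      using bnd[of "real (Suc k)"] by (intro AE_I2) (simp add: divide_le_eq del: of_nat_Suc)
  qed auto
  moreover have "expectation (\<lambda>\<omega>. indicator {0} (Y \<omega>)) = prob {\<omega> \<in> space M. Y \<omega> = 0}"
    by (subst Bochner_Integration.integral_cong[OF refl, of _ _ "indicator {\<omega> \<in> space M. Y \<omega> = 0}"])
       (auto split: split_indicator)
  ultimately show ?thesis by (simp add: fub)
qed

section \<open>Bounding the atoms of a weighted Bernoulli sum\<close>

text \<open>Jensen's inequality for exp with the weights \<open>w i / L\<close>. It separates the
  frequencies: a product of factors with different frequencies becomes a sum of terms with one
  frequency each.\<close>

lemma exp_weighted_sum_le:
  fixes w y :: "'i \<Rightarrow> real"
  assumes "finite I" "\<And>i. i \<in> I \<Longrightarrow> 0 \<le> w i" and L: "L = sum w I" "0 < L"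
  shows "exp (\<Sum>i\<in>I. - w i * y i) \<le> (\<Sum>i\<in>I. w i / L * exp (- L * y i))"
proof -
  have "exp (\<Sum>i\<in>I. (w i / L) *\<^sub>R (- L * y i)) \<le> (\<Sum>i\<in>I. w i / L * exp (- L * y i))"
    using assms
    by (intro convex_on_sum[OF _ _ exp_convex]) (auto simp: sum_divide_distrib[symmetric])
  then show ?thesis using L(2) by simp
qed

lemma (in prob_space) expectation_cos_bernoulli_sum_le:
  fixes X :: "nat \<Rightarrow> 'a \<Rightarrow> real"
  assumes "finite I" and bern: "\<And>i. i \<in> I \<Longrightarrow> bernoulli_rv M (X i) (p i)"
    and indep: "indep_vars (\<lambda>_. borel) X I"
    and L: "L = (\<Sum>i\<in>I. variance (X i))" "0 < L"
  shows "expectation (\<lambda>\<omega>. cos (t * ((\<Sum>i\<in>I. v i * X i \<omega>) - x)))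
    \<le> (\<Sum>i\<in>I. variance (X i) / L * exp (- L * (1 - cos (v i * t))))"
proof -
  have meas[measurable]: "\<And>i. i \<in> I \<Longrightarrow> X i \<in> borel_measurable M"
    using bern by (auto simp: bernoulli_rv_def)
  have indep': "indep_vars (\<lambda>_. borel) (\<lambda>i \<omega>. v i * X i \<omega>) I"
    by (rule indep_vars_compose2[OF indep]) auto
  have "expectation (\<lambda>\<omega>. cos (t * ((\<Sum>i\<in>I. v i * X i \<omega>) - x)))
      \<le> norm (char (distr M borel (\<lambda>\<omega>. \<Sum>i\<in>I. v i * X i \<omega>)) t)"
    by (rule expectation_cos_le_norm_char) measurable
  also have "\<dots> = (\<Prod>i\<in>I. norm (char (distr M borel (\<lambda>\<omega>. v i * X i \<omega>)) t))"
    by (simp add: char_distr_sum[OF indep'] prod_norm)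
  also have "\<dots> \<le> (\<Prod>i\<in>I. exp (- variance (X i) * (1 - cos (v i * t))))"
    by (intro prod_mono conjI norm_ge_zero norm_char_bernoulli_le[OF bern])
  also have "\<dots> = exp (\<Sum>i\<in>I. - variance (X i) * (1 - cos (v i * t)))"
    using \<open>finite I\<close> by (simp add: exp_sum)
  also have "\<dots> \<le> (\<Sum>i\<in>I. variance (X i) / L * exp (- L * (1 - cos (v i * t))))"
    using \<open>finite I\<close> L by (intro exp_weighted_sum_le) auto
  finally show ?thesis .
qed

lemma (in prob_space) atom_bernoulli_sum_le:
  fixes X :: "nat \<Rightarrow> 'a \<Rightarrow> real"
  assumes "finite I" and v: "\<And>i. i \<in> I \<Longrightarrow> v i \<noteq> 0"
    and bern: "\<And>i. i \<in> I \<Longrightarrow> bernoulli_rv M (X i) (p i)"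
    and indep: "indep_vars (\<lambda>_. borel) X I"
    and L: "L = (\<Sum>i\<in>I. variance (X i))" "0 < L"
  shows "prob {\<omega> \<in> space M. (\<Sum>i\<in>I. v i * X i \<omega>) = x}
    \<le> integral {0..1} (\<lambda>u. exp (- L * (1 - cos (pi * u))))"
    (is "_ \<le> ?J")
proof -
  have [measurable]: "\<And>i. i \<in> I \<Longrightarrow> X i \<in> borel_measurable M"
    using bern by (auto simp: bernoulli_rv_def)
  define w where "w i = variance (X i) / L" for i
  have w: "0 \<le> w i" "sum w I = 1" for i
    using L by (auto simp: w_def sum_divide_distrib[symmetric])
  define Y where "Y \<omega> = (\<Sum>i\<in>I. v i * X i \<omega>) - x" for \<omega>
  have [measurable]: "Y \<in> borel_measurable M" unfolding Y_def by measurable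
  define g where "g i t = exp (- L * (1 - cos (v i * t)))" for i t
  define a where "a k = (LBINT t:{0..real (Suc k)}. expectation (\<lambda>\<omega>. cos (t * Y \<omega>))) / real (Suc k)" for k
  \<comment> \<open>The frequency bound for each term, divided by the length \<open>Suc k\<close> of
    the interval and written so that the limit \<open>?J\<close> is visible termwise.\<close>
  define b where "b k = (\<Sum>i\<in>I. w i * ((1 + (2 * pi / \<bar>v i\<bar>) * inverse (real (Suc k))) * ?J))" for k
  have "a k \<le> b k" for k
  proof -
    let ?T = "real (Suc k)"
    have int: "set_integrable lborel {0..?T} (g i)" for i
      unfolding g_def by (intro borel_integrable_atLeastAtMost') (auto intro!: continuous_intros)
    have "(LBINT t:{0..?T}. expectation (\<lambda>\<omega>. cos (t * Y \<omega>)))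
        \<le> (LBINT t:{0..?T}. \<Sum>i\<in>I. w i * g i t)"
      unfolding set_lebesgue_integral_def
    \<comment> \<open>This rule asks for an integrable, nonnegative majorant; nonnegativity covers
      the case of a non-integrable left side, whose integral is 0 by convention.\<close>
    proof (rule integral_mono')
      show "integrable lborel (\<lambda>t. indicator {0..?T} t *\<^sub>R (\<Sum>i\<in>I. w i * g i t))"
        using int unfolding set_integrable_def
        by (simp add: sum_distrib_left mult.left_commute)
      show "indicator {0..?T} t *\<^sub>R expectation (\<lambda>\<omega>. cos (t * Y \<omega>))
          \<le> indicator {0..?T} t *\<^sub>R (\<Sum>i\<in>I. w i * g i t)" for t
        using expectation_cos_bernoulli_sum_le[OF \<open>finite I\<close> bern indep L]
        by (intro scaleR_left_mono) (auto simp: Y_def w_def g_def)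
      show "0 \<le> indicator {0..?T} t *\<^sub>R (\<Sum>i\<in>I. w i * g i t)" for t
        using w(1) by (auto simp: g_def intro!: mult_nonneg_nonneg sum_nonneg)
    qed
    also have "\<dots> = (\<Sum>i\<in>I. w i * (LBINT t:{0..?T}. g i t))"
      using int unfolding set_integrable_def set_lebesgue_integral_def
      by (simp add: sum_distrib_left mult.left_commute)
    also have "\<dots> \<le> (\<Sum>i\<in>I. w i * ((?T + 2 * pi / \<bar>v i\<bar>) * ?J))"
    proof (intro sum_mono mult_left_mono w)
      fix i assume "i \<in> I"
      have "integral {0..?T} (\<lambda>t. exp (- L * (1 - cos (v i * t)))) \<le> (?T + 2 * pi / \<bar>v i\<bar>) * ?J"
        using v[OF \<open>i \<in> I\<close>]
        by (intro integral_cos_frequency_le[where \<kappa> = "\<lambda>c. exp (- L * (1 - c))"])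
           (auto intro!: continuous_intros)
      then show "(LBINT t:{0..?T}. g i t) \<le> (?T + 2 * pi / \<bar>v i\<bar>) * ?J"
        unfolding set_borel_integral_eq_integral(2)[OF int] by (simp add: g_def[abs_def])
    qed
    finally have "a k \<le> (\<Sum>i\<in>I. w i * ((?T + 2 * pi / \<bar>v i\<bar>) * ?J)) / ?T"
      unfolding a_def by (intro divide_right_mono) auto
    also have "\<dots> = b k"
      unfolding b_def sum_divide_distrib
      by (intro sum.cong refl) (simp add: field_simps del: of_nat_Suc)
    finally show ?thesis .
  qed
  moreover have "a \<longlonglongrightarrow> prob {\<omega> \<in> space M. Y \<omega> = 0}"
    unfolding a_def by (rule time_average_LIMSEQ_atom) measurable
  moreover have "b \<longlonglongrightarrow> (\<Sum>i\<in>I. w i * ((1 + (2 * pi / \<bar>v i\<bar>) * 0) * ?J))"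
    unfolding b_def by (intro tendsto_intros LIMSEQ_inverse_real_of_nat)
  then have "b \<longlonglongrightarrow> ?J"
    using w(2) by (simp add: sum_distrib_right[symmetric])
  ultimately have "prob {\<omega> \<in> space M. Y \<omega> = 0} \<le> ?J"
    by (intro LIMSEQ_le) auto
  then show ?thesis by (simp add: Y_def)
qed

theorem corollary5p4:
  fixes M :: "'a measure" and X :: "nat \<Rightarrow> 'a \<Rightarrow> real"
    and n :: nat and v p :: "nat \<Rightarrow> real" and \<sigma> :: real
  assumes "prob_space M"
    and "n \<ge> 1"
    and "\<And>i. i \<in> {1..n} \<Longrightarrow> v i \<noteq> 0"
    and "\<And>i. i \<in> {1..n} \<Longrightarrow> bernoulli_rv M (X i) (p i)"
    and "prob_space.indep_vars M (\<lambda>_. borel) X {1..n}"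
    and "\<sigma>\<^sup>2 = (\<Sum>j=1..n. prob_space.variance M (X j))"
    and "\<sigma>\<^sup>2 > 0"
  shows "conc0 M (\<lambda>\<omega>. \<Sum>i=1..n. v i * X i \<omega>)
           \<le> 1 / sqrt (6 * \<sigma>\<^sup>2) * integral {0..sqrt (6 * \<sigma>\<^sup>2)} (\<lambda>t. exp (- (t\<^sup>2) / 2))"
proof -
  interpret prob_space M by (rule assms(1))
  \<comment> \<open>Chosen so that (m u)^2 / 2 = 3 \<sigma>^2 u^2; the substitution t = m u then
    yields the Gaussian integrand.\<close>
  define m where "m = sqrt (6 * \<sigma>\<^sup>2)"
  have m: "0 < m" "m\<^sup>2 = 6 * \<sigma>\<^sup>2"
    using assms(7) by (auto simp: m_def)
  have "integral {0..1} (\<lambda>u. exp (- \<sigma>\<^sup>2 * (3 * u\<^sup>2))) = integral {0..1} (\<lambda>u. exp (- ((m * u)\<^sup>2) / 2))"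
    using m(2) by (simp add: power_mult_distrib mult_ac)
  also have "\<dots> = 1 / m * integral {0..m} (\<lambda>t. exp (- (t\<^sup>2) / 2))"
    using integral_Icc_stretch[OF m(1), of 1 "\<lambda>t. exp (- (t\<^sup>2) / 2)"] by simp
  finally have subst: "integral {0..1} (\<lambda>u. exp (- \<sigma>\<^sup>2 * (3 * u\<^sup>2)))
      = 1 / m * integral {0..m} (\<lambda>t. exp (- (t\<^sup>2) / 2))" .
  have "prob {\<omega> \<in> space M. (\<Sum>i=1..n. v i * X i \<omega>) = x}
      \<le> 1 / m * integral {0..m} (\<lambda>t. exp (- (t\<^sup>2) / 2))" for x
  proof -
    have "prob {\<omega> \<in> space M. (\<Sum>i=1..n. v i * X i \<omega>) = x}
        \<le> integral {0..1} (\<lambda>u. exp (- \<sigma>\<^sup>2 * (1 - cos (pi * u))))"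
      using assms by (intro atom_bernoulli_sum_le[where p = p]) auto
    also have "\<dots> \<le> integral {0..1} (\<lambda>u. exp (- \<sigma>\<^sup>2 * (3 * u\<^sup>2)))"
      by (rule integral_exp_cos_le) simp
    finally show ?thesis unfolding subst .
  qed
  then show ?thesis
    unfolding conc0_def m_def by (intro cSUP_least) auto
qed

end
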